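(* Let $\mathcal H$ be a complex, separable, infinite-dimensional Hilbert space, let $A$ be a compact operator on $\mathcal H$ and let $B\in\mathcal B(\mathcal H)$. Suppose that $J_2(A)$ is similar to $J_2(B)$. Then $A$ is similar to $B$.
   Context: $\mathcal B(\mathcal H)$ denotes the algebra of bounded linear operators on $\mathcal H$. For $T\in\mathcal B(\mathcal H)$, $J_2(T):=\begin{bmatrix} 0 & I \\ T & 0 \end{bmatrix}\in\mathcal B(\mathcal H\oplus\mathcal H)$. Bounded operators $X,Y$ on Hilbert spaces are similar if $Y=S^{-1}XS$ for some bounded invertible operator $S$ (with bounded inverse) between the relevant spaces. *)

theory Defs
  imports "HOL-Analysis.Analysis"
begin

text \<open>
  The library only has real inner product spaces. A complex Hilbert space is a complete real inner
  product space with a compatible complex structure: the real scalar product is the real part of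
  the complex one, so that norm, metric and topology are those of the library.
  The complex inner product is linear in its first argument.
\<close>

class complex_inner = real_inner +
  fixes scaleC :: "complex \<Rightarrow> 'a \<Rightarrow> 'a" (infixr \<open>*\<^sub>C\<close> 75)
    and cinner :: "'a \<Rightarrow> 'a \<Rightarrow> complex"
  assumes scaleC_add_right: "c *\<^sub>C (x + y) = c *\<^sub>C x + c *\<^sub>C y"
    and scaleC_add_left: "(c + d) *\<^sub>C x = c *\<^sub>C x + d *\<^sub>C x"
    and scaleC_scaleC: "c *\<^sub>C d *\<^sub>C x = (c * d) *\<^sub>C x"
    and scaleR_scaleC: "r *\<^sub>R x = complex_of_real r *\<^sub>C x"
    and cinner_commute: "cinner x y = cnj (cinner y x)"
    and cinner_add_left: "cinner (x + y) z = cinner x z + cinner y z"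
    and cinner_scaleC_left: "cinner (c *\<^sub>C x) y = c * cinner x y"
    and inner_eq_Re_cinner: "x \<bullet> y = Re (cinner x y)"

class complex_hilbert_space = complex_inner + complete_space

global_interpretation complex_vector:
  vector_space "scaleC :: complex \<Rightarrow> 'a \<Rightarrow> 'a::complex_inner"
  defines cspan = complex_vector.span
proof
  show "1 *\<^sub>C x = x" for x :: 'a
    using scaleR_scaleC[of 1 x] by simp
qed (simp_all add: scaleC_add_right scaleC_add_left scaleC_scaleC)

lemma cinner_self: "cinner x x = complex_of_real ((norm x)\<^sup>2)" for x :: "'a::complex_inner"
proof -
  have "Im (cinner x x) = 0"
    using arg_cong[OF cinner_commute[of x x], of Im] by simp
  then show ?thesis
    by (simp add: complex_eq_iff power2_norm_eq_inner inner_eq_Re_cinner)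
qed

text \<open>The Hilbert space direct sum of two spaces is their product type.\<close>

instantiation prod :: (complex_inner, complex_inner) complex_inner
begin

definition scaleC_prod_def: "c *\<^sub>C p = (c *\<^sub>C fst p, c *\<^sub>C snd p)"

definition cinner_prod_def: "cinner p q = cinner (fst p) (fst q) + cinner (snd p) (snd q)"

instance
proof
  fix p q :: "'a \<times> 'b"
  show "cinner p q = cnj (cinner q p)"
    using cinner_commute[of "fst p" "fst q"] cinner_commute[of "snd p" "snd q"]
    by (simp add: cinner_prod_def)
qed (simp_all add: scaleC_prod_def cinner_prod_def scaleC_add_right scaleC_add_left scaleC_scaleC
    scaleR_prod_def scaleR_scaleC cinner_add_left cinner_scaleC_left inner_prod_def
    inner_eq_Re_cinner algebra_simps)

end

instance prod :: (complex_hilbert_space, complex_hilbert_space) complex_hilbert_space ..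

definition bounded_clinear :: "('a::complex_inner \<Rightarrow> 'b::complex_inner) \<Rightarrow> bool" where
  "bounded_clinear T \<longleftrightarrow>
     Vector_Spaces.linear scaleC scaleC T \<and> (\<exists>K. \<forall>x. norm (T x) \<le> K * norm x)"

definition compact_operator :: "('a::complex_inner \<Rightarrow> 'b::complex_inner) \<Rightarrow> bool" where
  "compact_operator T \<longleftrightarrow> bounded_clinear T \<and> compact (closure (T ` cball 0 1))"

definition similar_operators ::
    "('a::complex_inner \<Rightarrow> 'a) \<Rightarrow> ('b::complex_inner \<Rightarrow> 'b) \<Rightarrow> bool" where
  "similar_operators X Y \<longleftrightarrow>
     (\<exists>(S :: 'b \<Rightarrow> 'a) (R :: 'a \<Rightarrow> 'b). bounded_clinear S \<and> bounded_clinear R \<and>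
        R \<circ> S = id \<and> S \<circ> R = id \<and> Y = R \<circ> X \<circ> S)"

text \<open>The block operator matrix with rows \<open>0, I\<close> and \<open>T, 0\<close>, acting on column vectors.\<close>

definition J2 :: "('a \<Rightarrow> 'a) \<Rightarrow> 'a \<times> 'a \<Rightarrow> 'a \<times> 'a" where
  "J2 T = (\<lambda>(x, y). (y, T x))"

lemma bounded_clinear_bounded_linear: "bounded_clinear T \<Longrightarrow> bounded_linear T"
proof -
  assume T: "bounded_clinear T"
  then interpret T: Vector_Spaces.linear scaleC scaleC T
    by (simp add: bounded_clinear_def)
  obtain K where "\<forall>x. norm (T x) \<le> K * norm x"
    using T by (auto simp: bounded_clinear_def)
  then show ?thesis
    by (intro bounded_linear_intro[where K = K])
       (auto simp: T.add T.scale scaleR_scaleC mult.commute)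
qed

lemma bounded_clinear_J2: "bounded_clinear (J2 T)" if "bounded_clinear T"
proof -
  interpret T: Vector_Spaces.linear scaleC scaleC T
    using that by (simp add: bounded_clinear_def)
  interpret T': bounded_linear T
    using that by (rule bounded_clinear_bounded_linear)
  have "bounded_linear (J2 T)"
    unfolding J2_def case_prod_unfold
    by (intro bounded_linear_Pair bounded_linear_snd bounded_linear_compose[OF T'.bounded_linear_axioms]
        bounded_linear_fst)
  then obtain K where "\<forall>p. norm (J2 T p) \<le> K * norm p"
    using bounded_linear.bounded by (metis mult.commute)
  moreover have "Vector_Spaces.linear scaleC scaleC (J2 T)"
    by unfold_locales (auto simp: J2_def scaleC_prod_def T.add T.scale)
  ultimately show ?thesis
    by (auto simp: bounded_clinear_def)
qed

end

theory Submission
  imports Defs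
begin

text \<open>
  The intertwiner between \<^term>\<open>J2 A\<close> and \<^term>\<open>J2 B\<close> is a block matrix with rows \<open>X, Y\<close> and
  \<open>Y A, X\<close>, where \<open>X\<close> and \<open>Y\<close> both intertwine \<open>A\<close> and \<open>B\<close>; its inverse has rows \<open>Z, W\<close> and
  \<open>W B, Z\<close>. Every \<open>X + l Y\<close> intertwines \<open>A\<close> and \<open>B\<close>, and
  \<open>(Z + l W) (X + l Y) = I - W Y A + l\<^sup>2 W Y\<close>. The operator \<open>W Y\<close> commutes with \<open>A\<close> and
  \<open>W Y A\<close> is compact, so a Riesz-type argument shows that the right-hand side is injective for all
  but finitely many small \<open>l \<noteq> 0\<close>, and then it is bijective by the Fredholm alternative.
\<close>

section \<open>Compact operators and the Fredholm alternative\<close>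

text \<open>Riesz's lemma with constant 1/2: choose \<open>m\<close> in \<open>M\<close> whose
  distance to \<open>x\<close> is less than twice the infimum, and normalise
  \<open>x - m\<close>.\<close>

lemma riesz_almost_orthogonal:
  fixes M :: "'a::real_normed_vector set"
  assumes M: "subspace M" "closed M" and N: "subspace N" "M \<subseteq> N" "x \<in> N" and x: "x \<notin> M"
  obtains u where "u \<in> N" "norm u = 1" "\<And>z. z \<in> M \<Longrightarrow> 1/2 \<le> norm (u - z)"
proof -
  have ne: "M \<noteq> {}"
    using M(1) subspace_0 by auto
  have d: "infdist x M > 0"
    using M(2) ne x in_closed_iff_infdist_zero infdist_nonneg by (metis less_eq_real_def)
  have "\<exists>m\<in>M. dist x m < 2 * infdist x M"
  proof (rule ccontr)
    assume "\<not> ?thesis"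
    then have "2 * infdist x M \<le> infdist x M"
      using ne by (subst (2) infdist_notempty) (auto intro!: cINF_greatest)
    then show False
      using d by simp
  qed
  then obtain m where m: "m \<in> M" "dist x m < 2 * infdist x M"
    by blast
  define c where "c = norm (x - m)"
  have c: "c > 0" "c < 2 * infdist x M"
    using m x by (auto simp: c_def dist_norm)
  show thesis
  proof (rule that)
    show "(1/c) *\<^sub>R (x - m) \<in> N"
      using N m by (meson subsetD subspace_diff subspace_scale)
    show "norm ((1/c) *\<^sub>R (x - m)) = 1"
      using c by (simp add: c_def)
    fix z assume z: "z \<in> M"
    have "m + c *\<^sub>R z \<in> M"
      using M(1) m(1) z by (simp add: subspace_add subspace_scale)
    then have "infdist x M \<le> norm (x - (m + c *\<^sub>R z))"
      by (metis dist_norm infdist_le)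
    also have "x - (m + c *\<^sub>R z) = c *\<^sub>R ((1/c) *\<^sub>R (x - m) - z)"
      using c by (simp add: algebra_simps)
    finally have "infdist x M \<le> c * norm ((1/c) *\<^sub>R (x - m) - z)"
      using c by simp
    then have "c * (1/2) < c * norm ((1/c) *\<^sub>R (x - m) - z)"
      using c by linarith
    then show "1/2 \<le> norm ((1/c) *\<^sub>R (x - m) - z)"
      using c by simp
  qed
qed

lemma compact_image_subseq:
  fixes L :: "'a::real_normed_vector \<Rightarrow> 'b::real_normed_vector"
  assumes "compact (closure (L ` cball 0 1))" and "\<And>k::nat. norm (x k) \<le> 1"
  obtains r l where "strict_mono r" "(\<lambda>k. L (x (r k))) \<longlonglongrightarrow> l"
proof -
  have "\<forall>k. L (x k) \<in> closure (L ` cball 0 1)"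
    using assms(2) closure_subset by fastforce
  then obtain l r where "strict_mono r" "((\<lambda>k. L (x k)) \<circ> r) \<longlonglongrightarrow> l"
    using assms(1) unfolding compact_def by meson
  then show thesis
    using that by (simp add: o_def)
qed

text \<open>Along a subsequence the images converge, hence are Cauchy. Both Riesz arguments below
  end by contradicting this with \<open>e = 1/4\<close>.\<close>

lemma compact_image_not_separated:
  fixes L :: "'a::real_normed_vector \<Rightarrow> 'b::real_normed_vector"
  assumes "compact (closure (L ` cball 0 1))" and "\<And>k::nat. norm (x k) \<le> 1" and "e > 0"
  obtains i j where "i < j" "norm (L (x i) - L (x j)) < e"
proof -
  obtain r l where r: "strict_mono r" "(\<lambda>k. L (x (r k))) \<longlonglongrightarrow> l"
    using compact_image_subseq assms by blast
  then have "Cauchy (\<lambda>k. L (x (r k)))"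
    using LIMSEQ_imp_Cauchy by blast
  then obtain M where "\<forall>m\<ge>M. \<forall>n\<ge>M. norm (L (x (r m)) - L (x (r n))) < e"
    using \<open>e > 0\<close> unfolding Cauchy_iff by blast
  then have "norm (L (x (r M)) - L (x (r (Suc M)))) < e"
    by simp
  moreover have "r M < r (Suc M)"
    using r(1) by (simp add: strict_mono_Suc_iff)
  ultimately show thesis
    using that by blast
qed

lemma compact_closure_image_compose:
  fixes L :: "'a::real_normed_vector \<Rightarrow> 'b::real_normed_vector"
    and U :: "'b \<Rightarrow> 'c::real_normed_vector"
  assumes "bounded_linear U" and "compact (closure (L ` cball 0 1))"
  shows "compact (closure ((\<lambda>x. U (L x)) ` cball 0 1))"
proof -
  have "compact (U ` closure (L ` cball 0 1))"
    using assms by (intro compact_continuous_image linear_continuous_on)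
  moreover from this have "closure ((\<lambda>x. U (L x)) ` cball 0 1) \<subseteq> U ` closure (L ` cball 0 1)"
    using closure_subset by (intro closure_minimal compact_imp_closed) fastforce+
  ultimately show ?thesis
    by (metis closed_closure compact_Int_closed inf.absorb_iff2)
qed

text \<open>Fredholm alternative for an injective \<open>I + D - L\<close> with \<open>L\<close>
  compact and \<open>D\<close> small. The term \<open>D\<close> is kept apart because in the
  application it is a small multiple of an operator that need not be compact.\<close>

locale compact_perturbation =
  fixes D L G :: "'a::banach \<Rightarrow> 'a"
  assumes D: "bounded_linear D" and L: "bounded_linear L"
    and small: "\<And>x. norm (D x) \<le> norm x / 8"
    and compact: "compact (closure (L ` cball 0 1))"
    and inj: "\<And>x. x + D x - L x = 0 \<Longrightarrow> x = 0"
    and G: "G = (\<lambda>x. x + D x - L x)"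
begin

interpretation D: bounded_linear D by (rule D)
interpretation L: bounded_linear L by (rule L)

lemma bounded_linear: "bounded_linear G"
  unfolding G by (intro bounded_linear_add bounded_linear_sub bounded_linear_ident D L)

interpretation G: bounded_linear G by (rule bounded_linear)

text \<open>Otherwise there are unit vectors with \<open>G (x k)\<close> tending to 0. Along a
  subsequence \<open>L\<close> converges, so \<open>I + D\<close> does too. As \<open>D\<close> is
  small, the vectors themselves converge, and their limit is a unit vector in the kernel of
  \<open>G\<close>.\<close>

lemma bounded_below: "\<exists>c>0. \<forall>x. c * norm x \<le> norm (G x)"
proof (rule ccontr)
  assume "\<not> ?thesis"
  then have neg: "\<exists>x. norm (G x) < c * norm x" if "c > 0" for c
    using that by (meson not_le)
  have "\<exists>x. norm x = 1 \<and> norm (G x) < inverse (real (Suc k))" for k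
  proof -
    obtain x where x: "norm (G x) < inverse (real (Suc k)) * norm x"
      using neg[of "inverse (real (Suc k))"] by auto
    then have x0: "norm x > 0"
      by (cases "x = 0") (auto simp: G.zero)
    have "norm (G ((1 / norm x) *\<^sub>R x)) = norm (G x) / norm x"
      by (simp add: G.scale)
    also have "\<dots> < inverse (real (Suc k))"
      using x x0 by (simp add: pos_divide_less_eq)
    finally show ?thesis
      using x0 by (intro exI[of _ "(1 / norm x) *\<^sub>R x"]) simp
  qed
  then obtain x where x: "\<And>k. norm (x k) = 1" "\<And>k. norm (G (x k)) < inverse (real (Suc k))"
    by metis
  have "(\<lambda>k. G (x k)) \<longlonglongrightarrow> 0"
    using x(2) by (intro tendsto_norm_zero_cancel[OF tendsto_sandwich[OF _ _ tendsto_const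
          LIMSEQ_inverse_real_of_nat]]) (auto intro!: always_eventually less_imp_le)
  obtain r l where r: "strict_mono r" "(\<lambda>k. L (x (r k))) \<longlonglongrightarrow> l"
    using compact_image_subseq[OF compact, of x] x(1) by (metis order_refl)
  define y where "y = x \<circ> r"
  have Gy: "(\<lambda>k. G (y k)) \<longlonglongrightarrow> 0"
    using LIMSEQ_subseq_LIMSEQ[OF \<open>(\<lambda>k. G (x k)) \<longlonglongrightarrow> 0\<close> r(1)] by (simp add: y_def o_def)
  then have "(\<lambda>k. G (y k) + L (y k)) \<longlonglongrightarrow> 0 + l"
    using r(2) by (intro tendsto_add) (auto simp: y_def)
  then have C: "Cauchy (\<lambda>k. y k + D (y k))"
    using LIMSEQ_imp_Cauchy by (simp add: G)
  have step: "norm (y m - y n) \<le> 2 * norm ((y m + D (y m)) - (y n + D (y n)))" for m n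
  proof -
    have "norm (y m - y n) \<le> norm ((y m - y n) + D (y m - y n)) + norm (D (y m - y n))"
      by (metis add_diff_cancel_right' norm_triangle_ineq4)
    also have "norm (D (y m - y n)) \<le> norm (y m - y n) / 8"
      by (rule small)
    finally have "norm (y m - y n) \<le> 2 * norm ((y m - y n) + D (y m - y n))"
      using norm_ge_zero[of "y m - y n"] by linarith
    then show ?thesis
      by (simp add: D.diff algebra_simps)
  qed
  have "Cauchy y"
    unfolding Cauchy_iff
  proof (intro allI impI)
    fix e :: real assume "e > 0"
    then obtain M where "\<forall>m\<ge>M. \<forall>n\<ge>M. norm ((y m + D (y m)) - (y n + D (y n))) < e / 2"
      using C unfolding Cauchy_iff by (meson half_gt_zero)
    then have "\<forall>m\<ge>M. \<forall>n\<ge>M. norm (y m - y n) < e"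
      using step by (smt (verit) field_sum_of_halves)
    then show "\<exists>M. \<forall>m\<ge>M. \<forall>n\<ge>M. norm (y m - y n) < e" ..
  qed
  then obtain v where v: "y \<longlonglongrightarrow> v"
    using Cauchy_convergent convergent_def by blast
  have "G v = 0"
    using LIMSEQ_unique[OF G.tendsto[OF v] Gy] .
  then have "v = 0"
    using inj by (simp add: G)
  moreover have "norm v = 1"
    using LIMSEQ_unique[OF tendsto_norm[OF v], of 1] x(1) by (simp add: y_def)
  ultimately show False
    by simp
qed

text \<open>If the injective \<open>G\<close> is not onto, the ranges \<open>R k\<close> of its
  powers form a strictly decreasing chain of closed subspaces. Riesz vectors chosen along the chain
  have images under \<open>L\<close> that stay at least 1/4 apart, against compactness.\<close>

lemma surj: "surj G"
proof (rule ccontr)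
  assume ns: "\<not> surj G"
  define R where "R k = range (G ^^ k)" for k
  have lin: "bounded_linear (G ^^ k)" for k
    by (induction k) (auto simp: id_def[symmetric] o_def bounded_linear_compose[OF bounded_linear]
        intro: bounded_linear_ident[folded id_def])
  have sub: "subspace (R k)" for k
    unfolding R_def by (metis lin bounded_linear.linear linear_subspace_image subspace_UNIV)
  obtain c where c: "c > 0" "\<And>x. c * norm x \<le> norm (G x)"
    using bounded_below by blast
  have inj_G: "inj G"
    unfolding linear_injective_0[OF G.linear_axioms] using inj by (simp add: G)
  have RSuc: "R (Suc k) = G ` R k" for k
    by (simp add: R_def image_comp)
  \<comment> \<open>Being bounded below, \<open>G\<close> maps complete subspaces to complete
    ones.\<close>
  have "closed (R k)" for k
  proof (induction k)
    case (Suc k)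
    have "complete (G ` R k)"
      using complete_isometric_image[OF c(1) sub bounded_linear, of k] c(2) Suc
      by (simp add: complete_eq_closed)
    then show ?case
      by (simp add: RSuc complete_eq_closed)
  qed (simp add: R_def)
  have dec: "R (Suc k) \<subseteq> R k" for k
    unfolding R_def by (auto simp: funpow_swap1)
  have mono: "R j \<subseteq> R k" if "k \<le> j" for j k
    using that dec by (rule lift_Suc_antimono_le[rotated])
  obtain y where y: "y \<notin> range G"
    using ns by blast
  have "(G ^^ k) y \<notin> R (Suc k)" for k
  proof
    assume "(G ^^ k) y \<in> R (Suc k)"
    then obtain z where "(G ^^ k) y = (G ^^ k) (G z)"
      unfolding R_def by (auto simp: funpow_swap1)
    moreover have "inj (G ^^ k)"
      using inj_G by simp
    ultimately show False
      using y by (metis injD rangeI)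
  qed
  then have "\<exists>u. u \<in> R k \<and> norm u = 1 \<and> (\<forall>z\<in>R (Suc k). 1/2 \<le> norm (u - z))" for k
    using riesz_almost_orthogonal[OF sub \<open>closed (R (Suc k))\<close> sub dec, of "(G ^^ k) y"]
    by (metis R_def rangeI)
  then obtain x where x: "\<And>k. x k \<in> R k" "\<And>k. norm (x k) = 1"
      "\<And>k z. z \<in> R (Suc k) \<Longrightarrow> 1/2 \<le> norm (x k - z)"
    by metis
  obtain i j where ij: "i < j" "norm (L (x i) - L (x j)) < 1/4"
    using compact_image_not_separated[OF compact, of x "1/4"] x(2) by auto
  have xj: "x j \<in> R (Suc i)"
    using x(1)[of j] mono[of "Suc i" j] ij(1) by auto
  have "G (x i) \<in> R (Suc i)" "G (x j) \<in> R (Suc i)"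
    using x(1)[of i] xj dec[of "Suc i"] RSuc by blast+
  \<comment> \<open>This vector is chosen because \<open>I - G = L - D\<close>: subtracting it from
    \<open>x i\<close> leaves \<open>L (x i) - L (x j)\<close> up to a \<open>D\<close> term of norm
    at most 1/4.\<close>
  then have "G (x i) + (x j - G (x j)) \<in> R (Suc i)"
    using xj sub by (meson subspace_add subspace_diff)
  then have "1/2 \<le> norm (x i - (G (x i) + (x j - G (x j))))"
    by (rule x(3))
  also have "x i - (G (x i) + (x j - G (x j))) = (L (x i) - L (x j)) - (D (x i) - D (x j))"
    by (simp add: G)
  also have "norm \<dots> \<le> norm (L (x i) - L (x j)) + norm (D (x i) - D (x j))"
    by (rule norm_triangle_ineq4)
  also have "norm (D (x i) - D (x j)) \<le> 1/8 + 1/8"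
    using small[of "x i"] small[of "x j"] x(2) norm_triangle_ineq4[of "D (x i)" "D (x j)"]
    by (smt (verit))
  finally show False
    using ij(2) by simp
qed

end

text \<open>Riesz's argument on eigenvalues, adapted to a family of commuting operators
  \<open>G k\<close>. If each one kills some \<open>v k \<noteq> 0\<close>, the kernels of their
  successive products increase strictly, and Riesz vectors along this chain contradict the
  compactness of \<open>U A\<close>.\<close>

lemma injective_for_some_parameter:
  fixes U A :: "'a::banach \<Rightarrow> 'a" and \<mu> :: "nat \<Rightarrow> real"
  assumes U: "bounded_linear U" and A: "bounded_linear A" and comm: "\<And>x. U (A x) = A (U x)"
    and compact: "compact (closure ((\<lambda>x. U (A x)) ` cball 0 1))"
    and \<mu>: "inj \<mu>" and small: "\<And>k x. norm (\<mu> k *\<^sub>R U x) \<le> norm x / 8"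
  obtains k where "\<And>x. x + \<mu> k *\<^sub>R U x - U (A x) = 0 \<Longrightarrow> x = 0"
proof (rule ccontr)
  interpret U: bounded_linear U by (rule U)
  interpret A: bounded_linear A by (rule A)
  define G where "G k x = x + \<mu> k *\<^sub>R U x - U (A x)" for k x
  assume "\<not> thesis"
  then have "\<exists>x. x \<noteq> 0 \<and> G k x = 0" for k
    using that unfolding G_def by metis
  then obtain v where v: "\<And>k. v k \<noteq> 0" "\<And>k. G k (v k) = 0"
    by metis
  have lin_G: "bounded_linear (G k)" for k
    unfolding G_def
    by (intro bounded_linear_add bounded_linear_sub bounded_linear_ident
        bounded_linear_const_scaleR bounded_linear_compose[OF U] U A)
  \<comment> \<open>\<open>P m\<close> is the product of \<open>G 0, ..., G (m - 1)\<close>. The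
    factor \<open>G m\<close> first enters in \<open>P (Suc m)\<close>, so \<open>v m\<close> lies
    in \<open>N (Suc m)\<close>.\<close>
  define P where "P m = rec_nat id (\<lambda>k p. G k \<circ> p) m" for m
  have P0: "P 0 = id" and PSuc: "P (Suc m) = G m \<circ> P m" for m
    by (simp_all add: P_def)
  have lin_P: "bounded_linear (P m)" for m
    by (induction m) (auto simp: P0 PSuc o_def id_def bounded_linear_compose[OF lin_G])
  have GU: "G k (U x) = U (G k x)" and GA: "G k (A x) = A (G k x)" for k x
    by (simp_all add: G_def U.add U.diff U.scale A.add A.diff A.scale comm)
  have PUA: "P m (U (A x)) = U (A (P m x))" for m x
    by (induction m) (simp_all add: P0 PSuc GU GA)
  have GG: "G j (G k x) = G k (G j x)" for j k x
    unfolding G_def[of k] using bounded_linear.linear[OF lin_G[of j]]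
    by (simp add: GU GA linear_add linear_diff linear_scale)
  have PG: "P m (G k x) = G k (P m x)" for m k x
    by (induction m) (simp_all add: P0 PSuc GG)
  define N where "N m = {x. P m x = 0}" for m
  have sub: "subspace (N m)" for m
    unfolding N_def using linear_subspace_kernel[OF bounded_linear.linear[OF lin_P]] .
  have closed: "closed (N m)" for m
    unfolding N_def by (intro closed_Collect_eq linear_continuous_on lin_P continuous_on_const)
  have G0: "G k 0 = 0" for k
    by (simp add: G_def U.zero A.zero)
  have inc: "N m \<subseteq> N (Suc m)" for m
    by (auto simp: N_def PSuc G0)
  have mono: "N j \<subseteq> N k" if "j \<le> k" for j k
    using that inc by (rule lift_Suc_mono_le[rotated])
  have GN: "G m x \<in> N m" if "x \<in> N (Suc m)" for m x
    using that by (simp add: N_def PSuc PG)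
  have LN: "U (A x) \<in> N m" if "x \<in> N m" for m x
    using that by (simp add: N_def PUA U.zero A.zero)
  have vN: "v m \<in> N (Suc m)" for m
    using PG[of m m "v m"] v(2) bounded_linear.linear[OF lin_P[of m]]
    by (simp add: N_def PSuc linear_0)
  txt \<open>On \<open>v m\<close> the operator \<open>U\<close> has the inverse \<open>A - \<mu> m\<close>.\<close>
  have Uinj: "(U ^^ j) (v m) \<noteq> 0" for j m
  proof (induction j)
    case (Suc j)
    have com: "(U ^^ j) (U x) = U ((U ^^ j) x)" "(U ^^ j) (A x) = A ((U ^^ j) x)" for x
      by (induction j) (simp_all add: comm)
    have lin: "linear (U ^^ j)"
      by (induction j) (auto simp: id_def[symmetric] linear_id o_def intro: linear_compose[OF _ U.linear_axioms, unfolded o_def])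
    have "v m = U (A (v m) - \<mu> m *\<^sub>R v m)"
      using v(2)[of m] by (simp add: G_def U.diff U.scale algebra_simps eq_diff_eq)
    then have "(U ^^ j) (v m) = (U ^^ j) (U (A (v m) - \<mu> m *\<^sub>R v m))"
      by simp
    also have "\<dots> = A ((U ^^ Suc j) (v m)) - \<mu> m *\<^sub>R (U ^^ Suc j) (v m)"
      using lin by (simp add: com linear_diff linear_scale U.diff U.scale comm)
    finally show ?case
      using Suc by (auto simp: A.zero)
  qed (use v in simp)
  \<comment> \<open>Since \<open>G m (v m) = 0\<close>, each factor \<open>G j\<close> with
    \<open>j < m\<close> acts on \<open>v m\<close> as \<open>(\<mu> j - \<mu> m) U\<close>, with a
    nonzero scalar. With \<open>Uinj\<close> this gives \<open>P m (v m) \<noteq> 0\<close>, so the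
    chain of kernels is strict.\<close>
  have Pv: "\<exists>c. c \<noteq> 0 \<and> P j (v m) = c *\<^sub>R (U ^^ j) (v m)" if "j \<le> m" for j m
    using that
  proof (induction j)
    case 0
    show ?case by (rule exI[of _ 1]) (simp add: P0)
  next
    case (Suc j)
    then obtain c where c: "c \<noteq> 0" "P j (v m) = c *\<^sub>R (U ^^ j) (v m)"
      by auto
    have com: "G j ((U ^^ i) x) = (U ^^ i) (G j x)" for i x
      by (induction i) (simp_all add: GU)
    have "G j (v m) = G m (v m) + (\<mu> j - \<mu> m) *\<^sub>R U (v m)"
      by (simp add: G_def algebra_simps)
    then have Gv: "G j (v m) = (\<mu> j - \<mu> m) *\<^sub>R U (v m)"
      by (simp add: v(2))
    have lin: "linear (U ^^ i)" for i
      by (induction i) (auto simp: id_def[symmetric] linear_id o_def intro: linear_compose[OF _ U.linear_axioms, unfolded o_def])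
    have "P (Suc j) (v m) = c *\<^sub>R (U ^^ j) (G j (v m))"
      using bounded_linear.linear[OF lin_G[of j]] by (simp add: PSuc c linear_scale com)
    also have "\<dots> = (c * (\<mu> j - \<mu> m)) *\<^sub>R (U ^^ Suc j) (v m)"
      by (simp add: Gv linear_scale[OF lin] funpow_swap1)
    finally show ?case
      using c(1) Suc.prems \<mu> by (intro exI[of _ "c * (\<mu> j - \<mu> m)"]) (auto dest: injD)
  qed
  have "v m \<notin> N m" for m
    using Pv[of m m] Uinj[of m m] by (auto simp: N_def)
  then have "\<exists>u. u \<in> N (Suc m) \<and> norm u = 1 \<and> (\<forall>z\<in>N m. 1/2 \<le> norm (u - z))" for m
    using riesz_almost_orthogonal[OF sub closed sub inc vN] by metis
  then obtain x where x: "\<And>m. x m \<in> N (Suc m)" "\<And>m. norm (x m) = 1"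
      "\<And>m z. z \<in> N m \<Longrightarrow> 1/2 \<le> norm (x m - z)"
    by metis
  obtain i j where ij: "i < j" "norm (U (A (x i)) - U (A (x j))) < 1/4"
    using compact_image_not_separated[OF compact, of x "1/4"] x(2) by auto
  \<comment> \<open>\<open>U A\<close> preserves every kernel and \<open>G j\<close> maps
    \<open>N (Suc j)\<close> into \<open>N j\<close>. So, up to the term
    \<open>\<mu> j U (x j)\<close> of norm at most 1/8, the difference of the images is a difference
    between \<open>x j\<close> and a vector of \<open>N j\<close>.\<close>
  have "U (A (x i)) \<in> N j"
    using LN x(1)[of i] mono[of "Suc i" j] ij(1) by auto
  moreover have "G j (x j) \<in> N j"
    using GN x(1) by blast
  ultimately have "1/2 \<le> norm (x j - (G j (x j) + U (A (x i))))"
    using sub by (intro x(3)) (simp add: subspace_add)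
  also have "x j - (G j (x j) + U (A (x i))) = - (U (A (x i)) - U (A (x j))) - \<mu> j *\<^sub>R U (x j)"
    by (simp add: G_def)
  also have "norm \<dots> \<le> norm (U (A (x i)) - U (A (x j))) + norm (\<mu> j *\<^sub>R U (x j))"
    by (metis norm_minus_cancel norm_triangle_ineq4)
  also have "norm (\<mu> j *\<^sub>R U (x j)) \<le> 1/8"
    using small[of j "x j"] x(2) by simp
  finally show False
    using ij(2) by simp
qed

section \<open>Similarity of the blocks\<close>

lemma bounded_clinearI:
  assumes "bounded_linear T" and "\<And>c x. T (c *\<^sub>C x) = c *\<^sub>C T x"
  shows "bounded_clinear T"
proof -
  interpret bounded_linear T by (rule assms(1))
  obtain K where "\<forall>x. norm (T x) \<le> K * norm x"
    using bounded by (metis mult.commute)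
  moreover have "Vector_Spaces.linear scaleC scaleC T"
    by unfold_locales (auto simp: add assms(2))
  ultimately show ?thesis
    by (auto simp: bounded_clinear_def)
qed

lemma bounded_clinear_scaleC: "bounded_clinear T \<Longrightarrow> T (c *\<^sub>C x) = c *\<^sub>C T x"
  by (auto simp: bounded_clinear_def Vector_Spaces.linear_iff)

lemma similar_operatorsI:
  fixes T :: "'a::complex_inner \<Rightarrow> 'b::complex_inner"
  assumes T: "bounded_clinear T" and c: "c > 0" "\<And>x. c * norm x \<le> norm (T x)"
    and surj: "surj T" and inter: "\<And>x. T (A x) = B (T x)"
  shows "similar_operators A B"
proof -
  interpret T: bounded_linear T
    using T by (rule bounded_clinear_bounded_linear)
  have "inj T"
    unfolding linear_injective_0[OF T.linear_axioms]
  proof (intro allI impI)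
    fix x assume "T x = 0"
    then have "c * norm x \<le> 0"
      using c(2)[of x] by simp
    then show "x = 0"
      using c(1) by (simp add: mult_le_0_iff)
  qed
  then have iT: "inv T (T x) = x" and Ti: "T (inv T y) = y" for x y
    using surj by (simp_all add: surj_f_inv_f)
  have eq: "inv T y = x" if "y = T x" for x y
    using that iT by simp
  have "bounded_linear (inv T)"
  proof (rule bounded_linear_intro[where K = "1 / c"])
    show "inv T (x + y) = inv T x + inv T y" for x y
      by (rule eq) (simp add: T.add Ti)
    show "inv T (r *\<^sub>R x) = r *\<^sub>R inv T x" for r x
      by (rule eq) (simp add: T.scale Ti)
    show "norm (inv T x) \<le> norm x * (1 / c)" for x
      using c(2)[of "inv T x"] c(1) by (simp add: Ti field_simps)
  qed
  then have "bounded_clinear (inv T)"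
    by (rule bounded_clinearI) (rule eq, simp add: bounded_clinear_scaleC[OF T] Ti)
  moreover have "B = T \<circ> A \<circ> inv T"
    by (auto simp: inter Ti)
  ultimately show ?thesis
    \<comment> \<open>The definition puts the map from the second space to the first on the right,
      so that map is \<open>inv T\<close> and \<open>T\<close> is its inverse.\<close>
    unfolding similar_operators_def using T iT Ti
    by (intro exI[of _ "inv T"] exI[of _ T]) auto
qed

instance complex_hilbert_space \<subseteq> banach ..

text \<open>Evaluate the relation on \<open>(x, 0)\<close> and \<open>(0, x)\<close>. Because
  \<open>J2 A (0, x) = (x, 0)\<close>, the first column of \<open>R\<close> is \<open>J2 B\<close>
  applied to the second; the other evaluation then yields the two intertwining relations.\<close>

lemma J2_intertwiner:
  fixes R :: "'a::real_normed_vector \<times> 'a \<Rightarrow> 'a \<times> 'a"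
  assumes R: "bounded_linear R" and inter: "\<And>p. R (J2 A p) = J2 B (R p)"
  defines "X \<equiv> \<lambda>x. fst (R (x, 0))" and "Y \<equiv> \<lambda>x. fst (R (0, x))"
  assumes "A 0 = 0"
  shows "bounded_linear X" "bounded_linear Y"
    "\<And>x. X (A x) = B (X x)" "\<And>x. Y (A x) = B (Y x)" "\<And>x y. R (x, y) = (X x + Y y, Y (A x) + X y)"
proof -
  interpret R: bounded_linear R by (rule R)
  show "bounded_linear X" "bounded_linear Y"
    unfolding X_def Y_def
    by (intro bounded_linear_fst_comp bounded_linear_compose[OF R] bounded_linear_Pair
        bounded_linear_ident bounded_linear_zero)+
  have 1: "R (0, A x) = (snd (R (x, 0)), B (X x))" for x
    using inter[of "(x, 0)"] by (simp add: J2_def X_def case_prod_unfold)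
  have 2: "R (x, 0) = (snd (R (0, x)), B (Y x))" for x
    using inter[of "(0, x)"] by (simp add: J2_def Y_def case_prod_unfold \<open>A 0 = 0\<close>)
  have sX: "snd (R (0, x)) = X x" for x
    using 2[of x] by (simp add: X_def)
  show "X (A x) = B (X x)" for x
    using 1[of x] sX[of "A x"] by simp
  show YA: "Y (A x) = B (Y x)" for x
    using 1[of x] 2[of x] by (simp add: Y_def)
  show "R (x, y) = (X x + Y y, Y (A x) + X y)" for x y
  proof -
    have "R (x, y) = R (x, 0) + R (0, y)"
      by (simp flip: R.add)
    also have "R (x, 0) = (X x, Y (A x))"
      using 2[of x] by (simp add: sX YA)
    also have "R (0, y) = (Y y, X y)"
      using sX by (simp add: Y_def prod_eq_iff)
    finally show ?thesis
      by simp
  qed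
qed

theorem theorem4p10:
  fixes A B :: "'a::complex_hilbert_space \<Rightarrow> 'a"
  assumes separable: "separable_space (euclidean :: 'a topology)"
    and infinite_dim: "\<not> (\<exists>F :: 'a set. finite F \<and> cspan F = UNIV)"
    and compact_A: "compact_operator A"
    and bounded_B: "bounded_clinear B"
    and similar_J2: "similar_operators (J2 A) (J2 B)"
  shows "similar_operators A B"
proof -
  have bA: "bounded_linear A" and bB: "bounded_linear B"
    using compact_A bounded_B by (auto simp: compact_operator_def bounded_clinear_bounded_linear)
  then interpret A: bounded_linear A + B: bounded_linear B .
  obtain S R where SR: "bounded_clinear S" "bounded_clinear R" "R \<circ> S = id" "S \<circ> R = id"
    "J2 B = R \<circ> J2 A \<circ> S"
    using similar_J2 unfolding similar_operators_def by blast
  have RS: "R (S p) = p" "S (R p) = p" for p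
    using SR(3,4) by (metis comp_apply id_apply)+
  define X where "X x = fst (R (x, 0))" for x
  define Y where "Y x = fst (R (0, x))" for x
  define Z where "Z x = fst (S (x, 0))" for x
  define W where "W x = fst (S (0, x))" for x
  note bR = bounded_clinear_bounded_linear[OF SR(2)] and bS = bounded_clinear_bounded_linear[OF SR(1)]
  have "R (J2 A p) = J2 B (R p)" "S (J2 B p) = J2 A (S p)" for p
    by (simp_all add: SR(5) RS)
  note R = J2_intertwiner[OF bR this(1) A.zero, folded X_def Y_def]
    and S = J2_intertwiner[OF bS this(2) B.zero, folded Z_def W_def]
  interpret X: bounded_linear X by (rule R(1))
  interpret Y: bounded_linear Y by (rule R(2))
  interpret Z: bounded_linear Z by (rule S(1))
  interpret W: bounded_linear W by (rule S(2))
  \<comment> \<open>The next four identities are the top rows of \<open>S R = I\<close> and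
    \<open>R S = I\<close>.\<close>
  have ZX: "Z (X x) + W (Y (A x)) = x" for x
    using RS(2)[of "(x, 0)"] by (simp add: R(5) S(5) X.zero Y.zero)
  have ZY: "Z (Y x) + W (X x) = 0" for x
    using RS(2)[of "(0, x)"] by (simp add: R(5) S(5) X.zero Y.zero A.zero)
  have XZ: "X (Z x) + Y (W (B x)) = x" for x
    using RS(1)[of "(x, 0)"] by (simp add: R(5) S(5) Z.zero W.zero)
  have XW: "X (W x) + Y (Z x) = 0" for x
    using RS(1)[of "(0, x)"] by (simp add: R(5) S(5) Z.zero W.zero B.zero)
  define U where "U x = W (Y x)" for x
  have bU: "bounded_linear U"
    unfolding U_def by (intro bounded_linear_compose[OF S(2)] R(2))
  interpret U: bounded_linear U by (rule bU)
  have UA: "U (A x) = A (U x)" for x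
    by (simp add: U_def R(4) S(4))
  have compact: "compact (closure ((\<lambda>x. U (A x)) ` cball 0 1))"
    using compact_A by (intro compact_closure_image_compose[OF bU]) (simp add: compact_operator_def)
  obtain K where K: "K > 0" "\<And>x. norm (U x) \<le> norm x * K"
    using U.pos_bounded by blast
  \<comment> \<open>The factor \<open>1/(8 K)\<close> makes \<open>\<mu> k U\<close> have norm at
    most 1/8. The values are distinct, and positive so that a real square root \<open>l\<close>
    exists.\<close>
  define \<mu> where "\<mu> k = inverse (8 * K * real (Suc k))" for k
  have small: "norm (\<mu> k *\<^sub>R U x) \<le> norm x / 8" for k x
  proof -
    have "norm (\<mu> k *\<^sub>R U x) \<le> \<mu> k * (norm x * K)"
      using K by (simp add: \<mu>_def mult_left_mono)
    also have "\<dots> = norm x / 8 * inverse (real (Suc k))"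
      using K(1) by (simp add: \<mu>_def field_simps del: of_nat_Suc)
    also have "\<dots> \<le> norm x / 8 * 1"
      by (intro mult_left_mono) (auto simp: field_simps)
    finally show ?thesis by simp
  qed
  have "inj \<mu>"
    using K by (auto simp: inj_def \<mu>_def)
  then obtain k where inj: "\<And>x. x + \<mu> k *\<^sub>R U x - U (A x) = 0 \<Longrightarrow> x = 0"
    using injective_for_some_parameter[OF bU bA UA compact, of \<mu>] small by metis
  define l where "l = sqrt (\<mu> k)"
  have l: "l * l = \<mu> k"
    using K by (simp add: l_def \<mu>_def)
  define G where "G x = x + \<mu> k *\<^sub>R U x - U (A x)" for x
  interpret G: compact_perturbation "\<lambda>x. \<mu> k *\<^sub>R U x" "\<lambda>x. U (A x)" G
  proof (intro compact_perturbation.intro)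
    show "G = (\<lambda>x. x + \<mu> k *\<^sub>R U x - U (A x))"
      by (simp add: G_def fun_eq_iff)
  qed (fact inj small compact bounded_linear_const_scaleR[OF bU] bounded_linear_compose[OF bU bA])+
  define T where "T x = X x + l *\<^sub>R Y x" for x
  define V where "V x = Z x + l *\<^sub>R W x" for x
  have bT: "bounded_linear T" and bV: "bounded_linear V"
    unfolding T_def V_def by (intro bounded_linear_add bounded_linear_const_scaleR R(1,2) S(1,2))+
  \<comment> \<open>The coefficient of \<open>l\<close> vanishes by \<open>ZY\<close>, and that of
    \<open>l * l = \<mu> k\<close> is \<open>U\<close>.\<close>
  have VT: "V (T x) = G x" for x
  proof -
    have "V (T x) = Z (X x) + l *\<^sub>R (Z (Y x) + W (X x)) + (l * l) *\<^sub>R U x"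
      by (simp add: V_def T_def U_def Z.add Z.scale W.add W.scale algebra_simps)
    also have "Z (X x) = x - U (A x)"
      using ZX[of x] by (simp add: U_def eq_diff_eq)
    finally show ?thesis
      by (simp add: ZY l G_def)
  qed
  \<comment> \<open>\<open>C\<close> is chosen to make \<open>V T = I - C Y\<close> and
    \<open>T V = I - Y C\<close>; the first uses \<open>Y A = B Y\<close>. Surjectivity of
    \<open>G = V T\<close> can then be carried over to \<open>T V\<close>.\<close>
  define C where "C x = W (B x) - \<mu> k *\<^sub>R W x" for x
  have TV: "T (V x) = x - Y (C x)" for x
  proof -
    have "T (V x) = X (Z x) + l *\<^sub>R (X (W x) + Y (Z x)) + (l * l) *\<^sub>R Y (W x)"
      by (simp add: V_def T_def X.add X.scale Y.add Y.scale algebra_simps)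
    also have "X (Z x) = x - Y (W (B x))"
      using XZ[of x] by (simp add: eq_diff_eq)
    finally show ?thesis
      by (simp add: XW l C_def Y.diff Y.scale)
  qed
  have CY: "G x = x - C (Y x)" for x
    by (simp add: G_def C_def U_def R(4))
  have "surj T"
  proof (rule surjI)
    txt \<open>If \<open>I - C Y\<close> is surjective, so is \<open>I - Y C\<close>.\<close>
    fix y
    define u where "u = inv G (C y)"
    have u: "u - C (Y u) = C y"
      using surj_f_inv_f[OF G.surj] by (simp add: u_def flip: CY)
    \<comment> \<open>Hence \<open>I - Y C\<close> sends \<open>y + Y u\<close> to
      \<open>y + Y u - Y u = y\<close>.\<close>
    have "C (y + Y u) = u"
      using u by (simp add: C_def B.add W.add W.diff W.scale algebra_simps eq_diff_eq)
    then show "T (V (y + Y (inv G (C y)))) = y"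
      by (simp add: TV flip: u_def)
  qed
  obtain c where c: "c > 0" "\<And>x. c * norm x \<le> norm (G x)"
    using G.bounded_below by blast
  obtain M where M: "M > 0" "\<And>x. norm (V x) \<le> norm x * M"
    using bounded_linear.pos_bounded[OF bV] by blast
  \<comment> \<open>The lower bound for \<open>G = V T\<close> passes to \<open>T\<close> on
    dividing by the bound \<open>M\<close> of \<open>V\<close>.\<close>
  have "(c / M) * norm x \<le> norm (T x)" for x
    using order_trans[OF c(2)[of x], of "norm (T x) * M"] M(2)[of "T x"] M(1)
    by (simp add: VT field_simps)
  moreover have "bounded_clinear T"
  proof (rule bounded_clinearI[OF bT])
    have zero: "c *\<^sub>C (0::'a) = 0" for c
      by (rule complex_vector.scale_zero_right)
    have "X (c *\<^sub>C x) = c *\<^sub>C X x" "Y (c *\<^sub>C x) = c *\<^sub>C Y x" for c x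
      using bounded_clinear_scaleC[OF SR(2), of c "(x, 0)"] bounded_clinear_scaleC[OF SR(2), of c "(0, x)"]
      by (simp_all add: X_def Y_def scaleC_prod_def zero)
    then show "T (c *\<^sub>C x) = c *\<^sub>C T x" for c x
      by (simp add: T_def scaleR_scaleC scaleC_add_right scaleC_scaleC mult.commute)
  qed
  moreover have "T (A x) = B (T x)" for x
    by (simp add: T_def R(3,4) B.add B.scale)
  ultimately show ?thesis
    using similar_operatorsI[of T "c / M"] \<open>surj T\<close> c(1) M(1) by simp
qed

end
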